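(* Let $G$ be a finite simple graph of order $n$ with adjacency eigenvalues $\lambda_1(G)\geq\lambda_2(G)\geq\cdots\geq\lambda_n(G)$. Let $G_S$ be the self-loop graph of $G$, where $S\subseteq V(G)$ and $|S|=\sigma$ ($0\leq\sigma\leq n$), with eigenvalues $\lambda_1(G_S)\geq\cdots\geq\lambda_n(G_S)$. Then $$\lambda_i(G)\leq\lambda_i(G_S)\leq\lambda_i(G)+1,\qquad 1\leq i\leq n.$$ The left-hand inequality is attained (with equality for all $i$) for $\sigma=0$, and the right-hand inequality for $\sigma=n$.
   Context: For a simple graph $G$ and $S\subseteq V(G)$, the self-loop graph $G_S$ is obtained from $G$ by attaching one loop at each vertex of $S$; its adjacency matrix is $A(G_S)=A(G)+\mathfrak{I}_S$, where $\mathfrak{I}_S$ is the diagonal $0/1$ matrix with ones exactly at the positions corresponding to $S$. The eigenvalues of $G_S$ are those of $A(G_S)$. *)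

theory Defs
  imports
    "Graph_Theory.Pair_Digraph"
    "Jordan_Normal_Form.Char_Poly"
    "HOL-Library.Multiset"
begin

(* A finite simple graph is a pair_graph of Graph_Theory: an undirected edge {u,v} is the pair of
   opposite arcs (u,v), (v,u).  A loop at v is the single arc (v,v), so the self-loop graph is a
   pair_pre_digraph that is no longer loop-free. *)

definition self_loop_graph :: "'a pair_pre_digraph \<Rightarrow> 'a set \<Rightarrow> 'a pair_pre_digraph" where
  "self_loop_graph G S = G\<lparr>parcs := parcs G \<union> {(v, v) | v. v \<in> S}\<rparr>"

(* Rows and columns follow an enumeration vs of the vertices.  A loop contributes 1 (not 2) to the
   diagonal. *)

definition adj_matrix :: "'a list \<Rightarrow> 'a pair_pre_digraph \<Rightarrow> real mat" where
  "adj_matrix vs G = mat (length vs) (length vs)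
     (\<lambda>(i, j). if (vs ! i, vs ! j) \<in> parcs G then 1 else 0)"

definition loop_matrix :: "'a list \<Rightarrow> 'a set \<Rightarrow> real mat" where
  "loop_matrix vs S = mat (length vs) (length vs)
     (\<lambda>(i, j). if i = j \<and> vs ! i \<in> S then 1 else 0)"

lemma adj_matrix_self_loop_graph:
  assumes "pair_graph G" and "distinct vs"
  shows "adj_matrix vs (self_loop_graph G S) = adj_matrix vs G + loop_matrix vs S"
proof -
  interpret pair_graph G by fact
  have "(v, v) \<notin> parcs G" for v
    using pair_no_loops by fastforce
  then show ?thesis
    using assms(2)
    by (intro eq_matI)
       (auto simp: adj_matrix_def loop_matrix_def self_loop_graph_def nth_eq_iff_index_eq)
qed

(* lambda i A is the i-th largest eigenvalue, indices starting at 1, eigenvalues repeated according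
   to their multiplicity as roots of the characteristic polynomial.  Only real roots are counted,
   which for a symmetric matrix of size n are all n roots; lambda i A is meaningful for
   1 \<le> i \<le> n. *)

definition eigenvalues_desc :: "real mat \<Rightarrow> real list" where
  "eigenvalues_desc A = rev (sorted_list_of_multiset (proots (char_poly A)))"

definition lambda :: "nat \<Rightarrow> real mat \<Rightarrow> real" where
  "lambda i A = eigenvalues_desc A ! (i - 1)"

end

theory Submission
  imports Defs "Jordan_Normal_Form.Schur_Decomposition"
begin

text \<open>Since \<open>x \<bullet> (A(G\<^sub>S) x) = x \<bullet> (A(G) x) + (\<Sum>v\<in>S. x\<^sub>v\<^sup>2)\<close>, the quadratic form of \<open>A(G\<^sub>S)\<close> lies between
  those of \<open>A(G)\<close> and \<open>A(G) + I\<close>. By Weyl's monotonicity principle the \<open>i\<close>-th largest eigenvalues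
  are ordered in the same way: the span of eigenvectors for the \<open>i\<close> largest eigenvalues of one
  symmetric matrix meets, for dimension reasons, the span of eigenvectors for the \<open>n - i + 1\<close> smallest
  eigenvalues of the other, and the two forms are compared at a common vector. For \<open>S = V(G)\<close> the
  form of \<open>A(G) + I\<close> is attained, so monotonicity applies in the other direction as well.\<close>

section \<open>Real roots of the characteristic polynomial\<close>

text \<open>For an eigenvector \<open>v\<close>, the Hermitian form \<open>s\<close> equals
  \<open>z * q\<close>, where the squared norm \<open>q\<close> is real and nonzero. Conjugating the
  double sum for \<open>s\<close> and exchanging the two indices gives \<open>s\<close> back, since
  the entries of \<open>A\<close> are real and symmetric; hence \<open>z\<close> is its own
  conjugate.\<close>

lemma symmetric_real_mat_eigenvalue_real:
  fixes A :: "real mat"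
  assumes A: "A \<in> carrier_mat n n" and sym: "A\<^sup>T = A"
    and ev: "eigenvalue (map_mat complex_of_real A) z"
  shows "z \<in> \<real>"
proof -
  let ?B = "map_mat complex_of_real A"
  have B: "?B \<in> carrier_mat n n" using A by simp
  obtain v where v: "v \<in> carrier_vec n" "v \<noteq> 0\<^sub>v n" and Bv: "?B *\<^sub>v v = z \<cdot>\<^sub>v v"
    using ev A unfolding eigenvalue_def eigenvector_def by auto
  have symij: "A $$ (i, j) = A $$ (j, i)" if "i < n" "j < n" for i j
    using that A arg_cong[OF sym, of "\<lambda>M. M $$ (j, i)"] by simp
  define q where "q = v \<bullet>c v"
  have q0: "q \<noteq> 0" unfolding q_def using v by simp
  have qsum: "q = (\<Sum>i<n. v $ i * cnj (v $ i))"
    unfolding q_def scalar_prod_def using v by (auto intro!: sum.cong)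
  have qreal: "cnj q = q"
    unfolding qsum by (simp add: mult.commute)
  define s where "s = (?B *\<^sub>v v) \<bullet>c v"
  have s1: "s = z * q"
    unfolding s_def q_def Bv using v by simp
  have s2: "s = (\<Sum>i<n. \<Sum>j<n. of_real (A $$ (i, j)) * v $ j * cnj (v $ i))"
    unfolding s_def scalar_prod_def using v A
    by (auto intro!: sum.cong simp: scalar_prod_def sum_distrib_right)
  have "cnj s = (\<Sum>i<n. \<Sum>j<n. of_real (A $$ (i, j)) * cnj (v $ j) * v $ i)"
    unfolding s2 by simp
  also have "\<dots> = (\<Sum>j<n. \<Sum>i<n. of_real (A $$ (i, j)) * cnj (v $ j) * v $ i)"
    by (rule sum.swap)
  also have "\<dots> = s"
    unfolding s2 by (intro sum.cong refl) (auto simp: symij)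
  finally have "cnj z = z"
    using q0 qreal unfolding s1 by simp
  then show ?thesis
    by (simp add: Reals_cnj_iff)
qed

text \<open>Over the complex numbers the polynomial factors, and all its roots are eigenvalues,
  hence real. The factorization is therefore the image of a real one, and the embedding of real into
  complex polynomials is injective.\<close>

lemma symmetric_real_char_poly_splits:
  fixes A :: "real mat"
  assumes A: "A \<in> carrier_mat n n" and sym: "A\<^sup>T = A"
  shows "\<exists>es. char_poly A = (\<Prod>e\<leftarrow>es. [:- e, 1:])"
proof -
  interpret hp: map_poly_inj_idom_hom complex_of_real by unfold_locales
  let ?B = "map_mat complex_of_real A"
  have B: "?B \<in> carrier_mat n n" using A by simp
  obtain as where as: "char_poly ?B = (\<Prod>a\<leftarrow>as. [:- a, 1:])"
    using char_poly_factorized[OF B] by blast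
  have "a \<in> \<real>" if "a \<in> set as" for a
  proof -
    have "poly (char_poly ?B) a = 0"
      unfolding as using that by (induction as) auto
    then show ?thesis
      using symmetric_real_mat_eigenvalue_real[OF A sym] eigenvalue_root_char_poly[OF B] by blast
  qed
  then have re: "map of_real (map Re as) = as"
    by (induction as) (auto simp: of_real_Re)
  have "map_poly complex_of_real (char_poly A) = (\<Prod>a\<leftarrow>map of_real (map Re as). [:- a, 1:])"
    unfolding re using of_real_hom.char_poly_hom[OF A] as by (metis (no_types))
  also have "\<dots> = map_poly complex_of_real (\<Prod>e\<leftarrow>map Re as. [:- e, 1:])"
    by (simp add: hp.hom_prod_list o_def)
  finally show ?thesis
    using hp.injectivity by blast
qed

text \<open>Only real roots enter \<open>eigenvalues_desc\<close>; since the polynomial splits, none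
  is lost. The spectral theorem can then be asked for a diagonal in decreasing order.\<close>

lemma char_poly_eigenvalues_desc:
  fixes A :: "real mat"
  assumes A: "A \<in> carrier_mat n n" and sym: "A\<^sup>T = A"
  shows "char_poly A = (\<Prod>e\<leftarrow>eigenvalues_desc A. [:- e, 1:])"
proof -
  obtain es where es: "char_poly A = (\<Prod>e\<leftarrow>es. [:- e, 1:])"
    using symmetric_real_char_poly_splits[OF A sym] by blast
  \<comment> \<open>\<open>proots\<close> turns a product into a sum only when both factors are
    nonzero.\<close>
  have nz: "(\<Prod>e\<leftarrow>es. [:- e, 1:]) \<noteq> (0 :: real poly)" for es :: "real list"
    by (induction es) (auto simp del: mult_pCons_left)
  have "proots (\<Prod>e\<leftarrow>es. [:- e, 1:]) = mset es" for es :: "real list"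
  proof (induction es)
    case (Cons e es)
    have "proots ([:- e, 1:] * (\<Prod>e\<leftarrow>es. [:- e, 1:])) = {#e#} + mset es"
      using Cons nz by (subst proots_mult) auto
    then show ?case by simp
  qed simp
  then have "mset (eigenvalues_desc A) = mset es"
    unfolding eigenvalues_desc_def es by simp
  then have "mset (map (\<lambda>e. [:- e, 1:]) (eigenvalues_desc A)) = mset (map (\<lambda>e. [:- e, 1:]) es)"
    by simp
  then show ?thesis
    unfolding es by (metis prod_mset_prod_list)
qed

lemma eigenvalues_desc_antimono:
  assumes "i \<le> j" and "j < length (eigenvalues_desc A)"
  shows "eigenvalues_desc A ! j \<le> eigenvalues_desc A ! i"
  using assms sorted_rev_nth_mono[of "eigenvalues_desc A" i j]
  unfolding eigenvalues_desc_def by simp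

section \<open>Orthogonal diagonalization\<close>

text \<open>Gram-Schmidt applied to a basis that begins with \<open>v\<close> keeps \<open>v\<close>
  as first vector, so after normalization \<open>c\<close> is the reciprocal of the length of
  \<open>v\<close>. With an eigenvector as \<open>v\<close>, this matrix drives the deflation in the
  spectral theorem.\<close>

lemma orthogonal_mat_with_first_column:
  fixes v :: "real vec"
  assumes v: "v \<in> carrier_vec n" and v0: "v \<noteq> 0\<^sub>v n"
  shows "\<exists>W c. W \<in> carrier_mat n n \<and> W\<^sup>T * W = 1\<^sub>m n \<and> col W 0 = c \<cdot>\<^sub>v v"
proof -
  interpret cof_vec_space n "TYPE(real)" .
  have n: "n \<noteq> 0" using v v0 by auto
  define b where "b = basis_completion v"
  note b = basis_completion[OF v v0, folded b_def]
  define ws where "ws = gram_schmidt n b"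
  obtain vs where bv: "b = v # vs"
    using b(6,7) n by (cases b) auto
  have ws: "set ws \<subseteq> carrier_vec n" "corthogonal ws" "length ws = n"
    using gram_schmidt_result[OF b(2,4,5) refl, folded ws_def] b(6) by auto
  have "hd ws = v"
    using gram_schmidt_hd[OF v, of vs] unfolding ws_def bv .
  then have ws0: "ws ! 0 = v"
    using ws(3) n by (metis hd_conv_nth length_0_conv)
  have wsc: "ws ! i \<in> carrier_vec n" if "i < n" for i
    using ws that by (metis nth_mem subsetD)
  define r where "r i = sqrt (ws ! i \<bullet> ws ! i)" for i
  have pos: "ws ! i \<bullet> ws ! i > 0" if "i < n" for i
  proof -
    have "ws ! i \<bullet> ws ! i \<noteq> 0"
      using corthogonalD[OF ws(2), of i i] that ws(3) by simp
    moreover have "ws ! i \<bullet> ws ! i \<ge> 0"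
      unfolding scalar_prod_def by (intro sum_nonneg) simp
    ultimately show ?thesis by simp
  qed
  define W where "W = mat_of_cols n (map (\<lambda>i. (1 / r i) \<cdot>\<^sub>v ws ! i) [0..<n])"
  have W: "W \<in> carrier_mat n n" unfolding W_def by (auto simp: mat_of_cols_def)
  have colW: "col W i = (1 / r i) \<cdot>\<^sub>v ws ! i" if "i < n" for i
    unfolding W_def using that wsc[OF that] by (subst col_mat_of_cols) auto
  have "W\<^sup>T * W = 1\<^sub>m n"
  proof (rule eq_matI)
    fix i j assume "i < dim_row (1\<^sub>m n)" "j < dim_col (1\<^sub>m n)"
    then have ij: "i < n" "j < n" by auto
    have "(W\<^sup>T * W) $$ (i, j) = (1 / r i) * (1 / r j) * (ws ! i \<bullet> ws ! j)"
      using ij W colW smult_scalar_prod_distrib[OF wsc, of i "(1 / r j) \<cdot>\<^sub>v ws ! j"]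
        scalar_prod_smult_distrib[OF wsc wsc] wsc
      by simp
    also have "\<dots> = (if i = j then 1 else 0)"
      using corthogonalD[OF ws(2), of i j] ij ws(3) pos[OF ij(1)]
      by (auto simp: r_def)
    finally show "(W\<^sup>T * W) $$ (i, j) = 1\<^sub>m n $$ (i, j)"
      using ij by simp
  qed (use W in auto)
  moreover have "col W 0 = (1 / r 0) \<cdot>\<^sub>v v"
    using colW[of 0] n ws0 by simp
  ultimately show ?thesis
    using W by blast
qed

text \<open>Induction on \<open>es\<close>: an orthogonal change of basis splits off one eigenvector
  for the head of the list, and the tail is the spectrum of the remaining block. As the order of
  \<open>es\<close> is free, the order of the diagonal can be prescribed.\<close>

theorem symmetric_real_mat_spectral:
  fixes A :: "real mat"
  assumes "A \<in> carrier_mat n n" and "A\<^sup>T = A"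
    and "char_poly A = (\<Prod>e\<leftarrow>es. [:- e, 1:])"
  shows "\<exists>U D. similar_mat_wit A D U (U\<^sup>T) \<and> diagonal_mat D \<and> diag_mat D = es"
  using assms
proof (induction es arbitrary: n A)
  case Nil
  \<comment> \<open>The empty product has degree 0, whereas the characteristic polynomial has degree
    \<open>n\<close>.\<close>
  then have "n = 0"
    using degree_monic_char_poly[of A n] by simp
  with Nil have "similar_mat_wit A A (1\<^sub>m n) ((1\<^sub>m n)\<^sup>T) \<and> diagonal_mat A \<and> diag_mat A = []"
    by (auto intro: similar_mat_wit_refl simp: diag_mat_def diagonal_mat_def)
  then show ?case by blast
next
  case (Cons e es)
  note A = Cons.prems(1) and sym = Cons.prems(2)
  have cp: "char_poly A = [:- e, 1:] * (\<Prod>e\<leftarrow>es. [:- e, 1:])"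
    using Cons.prems(3) by simp
  have "eigenvalue A e"
    unfolding eigenvalue_root_char_poly[OF A] cp by simp
  then obtain v where v: "v \<in> carrier_vec n" "v \<noteq> 0\<^sub>v n" and Av: "A *\<^sub>v v = e \<cdot>\<^sub>v v"
    using A unfolding eigenvalue_def eigenvector_def by auto
  have n: "n \<noteq> 0" using v by auto
  let ?m = "n - 1"
  obtain W c where W: "W \<in> carrier_mat n n" and WW: "W\<^sup>T * W = 1\<^sub>m n"
    and col0: "col W 0 = c \<cdot>\<^sub>v v"
    using orthogonal_mat_with_first_column[OF v] by blast
  have WT: "W\<^sup>T \<in> carrier_mat n n" using W by simp
  have WW': "W * W\<^sup>T = 1\<^sub>m n" by (rule mat_mult_left_right_inverse[OF WT W WW])
  define A' where "A' = W\<^sup>T * A * W"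
  have A': "A' \<in> carrier_mat n n" unfolding A'_def using W A by simp
  have "similar_mat_wit A' A (W\<^sup>T) W"
    by (rule similar_mat_witI[of _ _ n]) (use W A A' WW WW' in \<open>auto simp: A'_def\<close>)
  then have simA: "similar_mat_wit A A' W (W\<^sup>T)" by (rule similar_mat_wit_sym)
  have sym': "A'\<^sup>T = A'"
  proof -
    have "A'\<^sup>T = W\<^sup>T * (A\<^sup>T * W)"
      unfolding A'_def using W A by (simp add: transpose_mult[of _ n n _ n])
    also have "\<dots> = A'" unfolding A'_def sym using W A by simp
    finally show ?thesis .
  qed
  have symA': "A' $$ (i, j) = A' $$ (j, i)" if "i < n" "j < n" for i j
    using that A' arg_cong[OF sym', of "\<lambda>M. M $$ (j, i)"] by simp
  \<comment> \<open>The first column of \<open>W\<close> is a multiple of \<open>v\<close>, so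
    \<open>A\<close> scales it by \<open>e\<close>, and \<open>W\<^sup>T\<close> sends it to the
    first unit vector.\<close>
  have "col A' 0 = W\<^sup>T *\<^sub>v (A *\<^sub>v col W 0)"
    unfolding A'_def assoc_mult_mat[OF WT A W] using W WT A n
    by (simp only: col_mult2[of _ n n _ n] mult_carrier_mat[of _ n n _ n] neq0_conv)
  also have "A *\<^sub>v col W 0 = e \<cdot>\<^sub>v col W 0"
    unfolding col0 using A v Av by (simp add: mult_mat_vec smult_smult_assoc mult.commute)
  also have "W\<^sup>T *\<^sub>v (e \<cdot>\<^sub>v col W 0) = e \<cdot>\<^sub>v col (W\<^sup>T * W) 0"
    using W n by (subst mult_mat_vec[of _ n n]) (auto intro!: eq_vecI)
  finally have colA': "col A' 0 = e \<cdot>\<^sub>v unit_vec n 0" unfolding WW using n by simp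
  have A'0: "A' $$ (i, 0) = (if i = 0 then e else 0)" if "i < n" for i
    using arg_cong[OF colA', of "\<lambda>v. v $ i"] that A' n by auto
  obtain A1 A2 A0 A3 where split: "split_block A' 1 1 = (A1, A2, A0, A3)"
    by (cases "split_block A' 1 1") auto
  have "dim_row A' = 1 + ?m" "dim_col A' = 1 + ?m" using A' n by auto
  note blk = split_block[OF split this]
  have A3_ij: "A3 = mat ?m ?m (\<lambda>(i, j). A' $$ (Suc i, Suc j))"
    using split A' unfolding split_block_def Let_def by auto
  have A1: "A1 = mat 1 1 (\<lambda>_. e)"
    using split A'0[of 0] n unfolding split_block_def Let_def by auto
  have A0: "A0 = 0\<^sub>m ?m 1"
    using split A' A'0 n unfolding split_block_def Let_def by auto
  \<comment> \<open>Symmetry of \<open>A'\<close> carries the zeros of the first column over to the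
    first row.\<close>
  have A2: "A2 = 0\<^sub>m 1 ?m"
    using split A' A'0 n symA'[of 0] unfolding split_block_def Let_def by (auto intro!: eq_matI)
  have A3: "A3 \<in> carrier_mat ?m ?m" using blk by auto
  have "A3\<^sup>T = A3"
    unfolding A3_ij by (intro eq_matI) (auto intro: symA')
  \<comment> \<open>Cancelling the factor for \<open>e\<close> leaves the tail \<open>es\<close>, as
    the induction hypothesis requires.\<close>
  moreover have "char_poly A3 = (\<Prod>e\<leftarrow>es. [:- e, 1:])"
  proof -
    have "char_poly A = char_poly A'"
      using simA by (intro char_poly_similar) (auto simp: similar_mat_def)
    also have "\<dots> = char_poly A1 * char_poly A3"
      using blk unfolding blk(5) A0 by (intro char_poly_four_block_zeros_col) auto
    also have "char_poly A1 = [:- e, 1:]"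
      by (simp add: A1 char_poly_defs det_def sign_def)
    finally show ?thesis
      unfolding cp by (metis mult_cancel_left pCons_eq_0_iff zero_neq_one)
  qed
  ultimately obtain U D where U: "similar_mat_wit A3 D U (U\<^sup>T)" and D: "diagonal_mat D" "diag_mat D = es"
    using Cons.IH[OF A3] by blast
  note Uc = similar_mat_witD2[OF A3 U]
  \<comment> \<open>The extension acts as the identity on the eigenvector already split off, so its
    inverse is still its transpose.\<close>
  let ?U = "four_block_mat (1\<^sub>m 1) (0\<^sub>m 1 ?m) (0\<^sub>m ?m 1) U"
  let ?D = "four_block_mat A1 (0\<^sub>m 1 ?m) (0\<^sub>m ?m 1) D"
  have "similar_mat_wit A' ?D ?U
      (four_block_mat (1\<^sub>m 1) (0\<^sub>m 1 ?m) (0\<^sub>m ?m 1) (U\<^sup>T))"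
    unfolding blk(5)
    by (rule similar_mat_wit_four_block[OF similar_mat_wit_refl[of _ 1] U])
      (use blk Uc in \<open>auto simp: A0 A2\<close>)
  also have "four_block_mat (1\<^sub>m 1) (0\<^sub>m 1 ?m) (0\<^sub>m ?m 1) (U\<^sup>T) = ?U\<^sup>T"
    using Uc by (subst transpose_four_block_mat[of _ 1 1 _ ?m _ ?m]) auto
  finally have sim': "similar_mat_wit A' ?D ?U (?U\<^sup>T)" .
  have "?U\<^sup>T * W\<^sup>T = (W * ?U)\<^sup>T"
  proof -
    have "?U \<in> carrier_mat (1 + ?m) (1 + ?m)"
      by (rule four_block_carrier_mat[OF one_carrier_mat Uc(6)])
    then have "?U \<in> carrier_mat n n" using n by simp
    then show ?thesis by (rule transpose_mult[OF W, symmetric])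
  qed
  with similar_mat_wit_trans[OF simA sim']
  have "similar_mat_wit A ?D (W * ?U) ((W * ?U)\<^sup>T)" by simp
  moreover have "diagonal_mat ?D"
  proof -
    have "?D $$ (i, j) = 0" if "i < 1 + ?m" "j < 1 + ?m" "i \<noteq> j" for i j
      using that D(1) carrier_matD[OF Uc(5)] by (auto simp: A1 diagonal_mat_def)
    then show ?thesis
      using carrier_matD[OF Uc(5)] by (simp add: A1 diagonal_mat_def)
  qed
  moreover have "diag_mat ?D = e # es"
  proof -
    have "diag_mat ?D = diag_mat A1 @ diag_mat D"
      by (rule diag_four_block_mat[of _ 1, OF _ Uc(5)]) (simp add: A1)
    then show ?thesis
      by (simp add: D(2)) (simp add: A1 diag_mat_def)
  qed
  ultimately show ?case by blast
qed

section \<open>Quadratic forms and Weyl's monotonicity principle\<close>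

text \<open>\<open>U\<^sup>T *\<^sub>v x\<close> lists the coordinates of \<open>x\<close> in the
  orthonormal eigenbasis formed by the columns of \<open>U\<close>; there the form is diagonal, and
  the second claim is Parseval's identity.\<close>

lemma spectral_quadratic_form:
  fixes A :: "real mat"
  assumes A: "A \<in> carrier_mat n n" and sim: "similar_mat_wit A D U (U\<^sup>T)"
    and D: "diagonal_mat D" and x: "x \<in> carrier_vec n"
  shows "x \<bullet> (A *\<^sub>v x) = (\<Sum>k<n. diag_mat D ! k * ((U\<^sup>T *\<^sub>v x) $ k)\<^sup>2)"
    and "x \<bullet> x = (\<Sum>k<n. ((U\<^sup>T *\<^sub>v x) $ k)\<^sup>2)"
proof -
  note U = similar_mat_witD2[OF A sim]
  define y where "y = U\<^sup>T *\<^sub>v x"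
  have y: "y \<in> carrier_vec n" unfolding y_def using U x by auto
  have move: "x \<bullet> (U *\<^sub>v z) = y \<bullet> z" if "z \<in> carrier_vec n" for z
    unfolding y_def using U(6) that x transpose_vec_mult_scalar[of U n n z x] by simp
  have "A *\<^sub>v x = U *\<^sub>v (D *\<^sub>v y)"
    unfolding y_def U(3) using U(5-7) x by (simp add: assoc_mult_mat_vec[of _ n n _ n])
  then have "x \<bullet> (A *\<^sub>v x) = y \<bullet> (D *\<^sub>v y)"
    using move[of "D *\<^sub>v y"] U(5) y by simp
  also have "\<dots> = (\<Sum>k<n. diag_mat D ! k * (y $ k)\<^sup>2)"
  proof -
    have "(D *\<^sub>v y) $ k = diag_mat D ! k * y $ k" if k: "k < n" for k
    proof -
      have "(D *\<^sub>v y) $ k = (\<Sum>j<n. D $$ (k, j) * y $ j)"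
        using k U(5) y by (auto simp: scalar_prod_def intro!: sum.cong)
      also have "\<dots> = (\<Sum>j<n. if j = k then D $$ (k, k) * y $ k else 0)"
        using D k U(5) by (intro sum.cong) (auto simp: diagonal_mat_def)
      finally show ?thesis
        using k U(5) by (simp add: diag_mat_def)
    qed
    then show ?thesis
      using U(5) y unfolding scalar_prod_def
      by (auto intro!: sum.cong simp: power2_eq_square)
  qed
  finally show "x \<bullet> (A *\<^sub>v x) = (\<Sum>k<n. diag_mat D ! k * ((U\<^sup>T *\<^sub>v x) $ k)\<^sup>2)"
    unfolding y_def .
  have "x = U *\<^sub>v y"
    unfolding y_def using U(1,6,7) x by (simp flip: assoc_mult_mat_vec[of _ n n _ n])
  then have "x \<bullet> x = y \<bullet> y"
    using move[OF y] by simp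
  then show "x \<bullet> x = (\<Sum>k<n. ((U\<^sup>T *\<^sub>v x) $ k)\<^sup>2)"
    using y unfolding y_def[symmetric] scalar_prod_def
    by (auto intro!: sum.cong simp: power2_eq_square)
qed

text \<open>With \<open>M = V\<^sup>T U\<close> for two orthogonal matrices, \<open>U c\<close> is the common vector of the two eigenspans.\<close>

lemma mat_vec_kernel_complementary_support:
  fixes M :: "'a :: field mat"
  assumes M: "M \<in> carrier_mat n n" and i: "i < n"
  shows "\<exists>c \<in> carrier_vec n. c \<noteq> 0\<^sub>v n \<and> (\<forall>k. i < k \<longrightarrow> k < n \<longrightarrow> c $ k = 0) \<and>
    (\<forall>k<i. (M *\<^sub>v c) $ k = 0)"
proof -
  \<comment> \<open>The conditions on \<open>c\<close> become one square system: the rows above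
    \<open>i\<close> are those of \<open>M\<close>, the rows below \<open>i\<close> are unit rows
    that annihilate the late entries of \<open>c\<close>, and the zero row \<open>i\<close> makes
    the system singular.\<close>
  define K where "K = mat n n (\<lambda>(k, j).
    if k < i then M $$ (k, j) else if k = i then 0 else if k = j then 1 else 0)"
  have K: "K \<in> carrier_mat n n" unfolding K_def by simp
  have "det K = (\<Sum>j<n. K $$ (i, j) * cofactor K i j)"
    by (rule laplace_expansion_row[OF K i])
  also have "\<dots> = 0"
    using i by (intro sum.neutral) (auto simp: K_def)
  finally obtain c where c: "c \<in> carrier_vec n" "c \<noteq> 0\<^sub>v n" and Kc: "K *\<^sub>v c = 0\<^sub>v n"
    using det_0_iff_vec_prod_zero_field[OF K] by blast
  have Kc_k: "(\<Sum>j<n. K $$ (k, j) * c $ j) = 0" if "k < n" for k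
    using that arg_cong[OF Kc, of "\<lambda>v. v $ k"] K c
    by (simp add: scalar_prod_def lessThan_atLeast0)
  have "c $ k = 0" if k: "i < k" "k < n" for k
  proof -
    have "(\<Sum>j<n. K $$ (k, j) * c $ j) = (\<Sum>j<n. if j = k then c $ k else 0)"
      using k by (intro sum.cong) (auto simp: K_def)
    then show ?thesis using Kc_k[OF k(2)] k by simp
  qed
  moreover have "(M *\<^sub>v c) $ k = 0" if k: "k < i" for k
  proof -
    have "(\<Sum>j<n. K $$ (k, j) * c $ j) = (\<Sum>j<n. M $$ (k, j) * c $ j)"
      using k i by (intro sum.cong) (auto simp: K_def)
    then show ?thesis
      using Kc_k[of k] k i M c by (simp add: scalar_prod_def lessThan_atLeast0)
  qed
  ultimately show ?thesis using c by blast
qed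

text \<open>The shift \<open>t\<close> lets one statement serve the lower bound
  (\<open>t = 0\<close>), the upper bound (\<open>t = 1\<close>) and the equality case of all loops
  (\<open>t = -1\<close>).\<close>

theorem lambda_le_of_quadratic_form_le:
  fixes A B :: "real mat"
  assumes A: "A \<in> carrier_mat n n" "A\<^sup>T = A" and B: "B \<in> carrier_mat n n" "B\<^sup>T = B"
    and le: "\<And>x. x \<in> carrier_vec n \<Longrightarrow> x \<bullet> (A *\<^sub>v x) \<le> x \<bullet> (B *\<^sub>v x) + t * (x \<bullet> x)"
    and i: "i \<in> {1..n}"
  shows "lambda i A \<le> lambda i B + t"
proof -
  obtain U D where U: "similar_mat_wit A D U (U\<^sup>T)" and D: "diagonal_mat D"
    and a: "diag_mat D = eigenvalues_desc A"
    using symmetric_real_mat_spectral[OF A char_poly_eigenvalues_desc[OF A]] by blast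
  obtain V E where V: "similar_mat_wit B E V (V\<^sup>T)" and E: "diagonal_mat E"
    and b: "diag_mat E = eigenvalues_desc B"
    using symmetric_real_mat_spectral[OF B char_poly_eigenvalues_desc[OF B]] by blast
  note Uc = similar_mat_witD2[OF A(1) U] and Vc = similar_mat_witD2[OF B(1) V]
  have len: "length (eigenvalues_desc A) = n" "length (eigenvalues_desc B) = n"
    using Uc(5) Vc(5) by (simp_all flip: a b add: diag_mat_def)
  \<comment> \<open>Lists are indexed from 0: the \<open>i\<close>-th largest eigenvalue sits at
    position \<open>i - 1\<close>, the only index that neither \<open>high\<close> nor
    \<open>low\<close> excludes.\<close>
  have i': "i - 1 < n" using i by auto
  have "V\<^sup>T * U \<in> carrier_mat n n" using Uc Vc by auto
  then obtain c where c: "c \<in> carrier_vec n" "c \<noteq> 0\<^sub>v n"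
    and high: "\<And>k. i - 1 < k \<Longrightarrow> k < n \<Longrightarrow> c $ k = 0"
    and low: "\<And>k. k < i - 1 \<Longrightarrow> ((V\<^sup>T * U) *\<^sub>v c) $ k = 0"
    using mat_vec_kernel_complementary_support[OF _ i'] by blast
  \<comment> \<open>\<open>x\<close> combines the first \<open>i\<close> columns of
    \<open>U\<close>, eigenvectors for the \<open>i\<close> largest eigenvalues of \<open>A\<close>;
    by \<open>low\<close> its coordinates along the first \<open>i - 1\<close> columns of
    \<open>V\<close> vanish.\<close>
  define x where "x = U *\<^sub>v c"
  have x: "x \<in> carrier_vec n" unfolding x_def using Uc c by auto
  have Ux: "U\<^sup>T *\<^sub>v x = c"
    unfolding x_def using Uc c by (simp flip: assoc_mult_mat_vec[of _ n n _ n])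
  have Vx: "V\<^sup>T *\<^sub>v x = (V\<^sup>T * U) *\<^sub>v c"
    unfolding x_def using Uc Vc c by (simp add: assoc_mult_mat_vec[of _ n n _ n])
  note qA = spectral_quadratic_form[OF A(1) U D x, unfolded a Ux]
    and qB = spectral_quadratic_form[OF B(1) V E x, unfolded b Vx]
  have pos: "x \<bullet> x > 0"
  proof -
    obtain k where k: "k < n" "c $ k \<noteq> 0"
      using c by (metis carrier_vecD eq_vecI index_zero_vec)
    then show ?thesis
      unfolding qA(2) by (intro sum_pos2[of _ k]) auto
  qed
  \<comment> \<open>Terms with \<open>k > i - 1\<close> vanish by \<open>high\<close>; in the others
    the eigenvalue is at least the one at position \<open>i - 1\<close>.\<close>
  have "lambda i A * (x \<bullet> x) \<le> x \<bullet> (A *\<^sub>v x)"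
    unfolding qA sum_distrib_left
  proof (rule sum_mono)
    fix k assume k: "k \<in> {..<n}"
    show "lambda i A * (c $ k)\<^sup>2 \<le> eigenvalues_desc A ! k * (c $ k)\<^sup>2"
    proof (cases "i - 1 < k")
      case False
      then show ?thesis
        using eigenvalues_desc_antimono[of k "i - 1" A] len i' unfolding lambda_def
        by (intro mult_right_mono) auto
    qed (use high k in auto)
  qed
  also have "\<dots> \<le> x \<bullet> (B *\<^sub>v x) + t * (x \<bullet> x)" by (rule le[OF x])
  \<comment> \<open>Dually, \<open>low\<close> removes the terms with \<open>k < i - 1\<close>, and
    the remaining eigenvalues of \<open>B\<close> are at most the one at position
    \<open>i - 1\<close>.\<close>
  also have "x \<bullet> (B *\<^sub>v x) \<le> lambda i B * (x \<bullet> x)"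
    unfolding qB sum_distrib_left
  proof (rule sum_mono)
    fix k assume k: "k \<in> {..<n}"
    show "eigenvalues_desc B ! k * (((V\<^sup>T * U) *\<^sub>v c) $ k)\<^sup>2
      \<le> lambda i B * (((V\<^sup>T * U) *\<^sub>v c) $ k)\<^sup>2"
    proof (cases "k < i - 1")
      case False
      then show ?thesis
        using eigenvalues_desc_antimono[of "i - 1" k B] len k unfolding lambda_def
        by (intro mult_right_mono) auto
    qed (use low in auto)
  qed
  finally have "lambda i A * (x \<bullet> x) \<le> (lambda i B + t) * (x \<bullet> x)"
    by (simp add: distrib_right)
  then show ?thesis using pos by simp
qed

section \<open>Bounds and equality cases for self-loop graphs\<close>

lemma loop_matrix_quadratic_form:
  assumes "x \<in> carrier_vec (length vs)"
  shows "x \<bullet> (loop_matrix vs S *\<^sub>v x) = (\<Sum>k | k < length vs \<and> vs ! k \<in> S. (x $ k)\<^sup>2)"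
proof -
  have "(loop_matrix vs S *\<^sub>v x) $ k = (if vs ! k \<in> S then x $ k else 0)" if k: "k < length vs" for k
  proof -
    have "(loop_matrix vs S *\<^sub>v x) $ k
        = (\<Sum>j<length vs. (if k = j \<and> vs ! k \<in> S then 1 else 0) * x $ j)"
      using k assms by (auto simp: scalar_prod_def loop_matrix_def intro!: sum.cong)
    also have "\<dots> = (\<Sum>j<length vs. if j = k then (if vs ! k \<in> S then x $ k else 0) else 0)"
      by (intro sum.cong) auto
    finally show ?thesis using k by simp
  qed
  then have "x \<bullet> (loop_matrix vs S *\<^sub>v x)
      = (\<Sum>k<length vs. if vs ! k \<in> S then (x $ k)\<^sup>2 else 0)"
    using assms by (auto simp: scalar_prod_def loop_matrix_def power2_eq_square intro!: sum.cong)
  also have "\<dots> = (\<Sum>k | k < length vs \<and> vs ! k \<in> S. (x $ k)\<^sup>2)"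
    by (simp flip: sum.inter_filter)
  finally show ?thesis .
qed

theorem theorem3p1:
  fixes G :: "'a pair_pre_digraph" and S :: "'a set" and vs :: "'a list" and n \<sigma> :: nat
  assumes "pair_graph G"
    and "card (pverts G) = n"
    and "distinct vs" and "set vs = pverts G"
    and "S \<subseteq> pverts G"
    and "card S = \<sigma>"
  shows "(\<forall>i\<in>{1..n}.
           lambda i (adj_matrix vs G) \<le> lambda i (adj_matrix vs (self_loop_graph G S)) \<and>
           lambda i (adj_matrix vs (self_loop_graph G S)) \<le> lambda i (adj_matrix vs G) + 1) \<and>
         (\<sigma> = 0 \<longrightarrow> (\<forall>i\<in>{1..n}.
           lambda i (adj_matrix vs (self_loop_graph G S)) = lambda i (adj_matrix vs G))) \<and>
         (\<sigma> = n \<longrightarrow> (\<forall>i\<in>{1..n}.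
           lambda i (adj_matrix vs (self_loop_graph G S)) = lambda i (adj_matrix vs G) + 1))"
proof -
  interpret pair_graph G by fact
  let ?A = "adj_matrix vs G" and ?L = "loop_matrix vs S"
    and ?B = "adj_matrix vs (self_loop_graph G S)"
  have len: "length vs = n"
    using assms(2-4) by (metis distinct_card)
  have B_eq: "?B = ?A + ?L"
    by (rule adj_matrix_self_loop_graph[OF assms(1,3)])
  have A: "?A \<in> carrier_mat n n" and L: "?L \<in> carrier_mat n n" and B: "?B \<in> carrier_mat n n"
    using len by (simp_all add: adj_matrix_def loop_matrix_def)
  have "(u, v) \<in> parcs G \<longleftrightarrow> (v, u) \<in> parcs G" for u v
    using arcs_symmetric by blast
  then have A_sym: "?A\<^sup>T = ?A"
    by (intro eq_matI) (auto simp: adj_matrix_def)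
  have "?L\<^sup>T = ?L"
    by (intro eq_matI) (auto simp: loop_matrix_def)
  then have B_sym: "?B\<^sup>T = ?B"
    unfolding B_eq using A L A_sym by (simp add: transpose_add[of _ n n])
  have qB: "x \<bullet> (?B *\<^sub>v x) = x \<bullet> (?A *\<^sub>v x) + (\<Sum>k | k < n \<and> vs ! k \<in> S. (x $ k)\<^sup>2)"
    if x: "x \<in> carrier_vec n" for x
  proof -
    have "x \<bullet> (?B *\<^sub>v x) = x \<bullet> (?A *\<^sub>v x) + x \<bullet> (?L *\<^sub>v x)"
      unfolding B_eq using A L x
      by (subst add_mult_distrib_mat_vec[of _ n n]) (auto intro!: scalar_prod_add_distrib[of _ n])
    then show ?thesis
      using loop_matrix_quadratic_form[of x vs S] x len by simp
  qed
  have xx: "x \<bullet> x = (\<Sum>k<n. (x $ k)\<^sup>2)" if "x \<in> carrier_vec n" for x :: "real vec"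
    using that by (auto simp: scalar_prod_def power2_eq_square intro!: sum.cong)
  have lower: "lambda i ?A \<le> lambda i ?B + 0" if "i \<in> {1..n}" for i
    by (rule lambda_le_of_quadratic_form_le[OF A A_sym B B_sym _ that])
      (simp add: qB sum_nonneg)
  \<comment> \<open>The squares at looped vertices form part of the sum of all squares, which is
    \<open>x \<bullet> x\<close>.\<close>
  have upper: "lambda i ?B \<le> lambda i ?A + 1" if "i \<in> {1..n}" for i
    by (rule lambda_le_of_quadratic_form_le[OF B B_sym A A_sym _ that])
      (auto simp: qB xx intro!: sum_mono2)
  have zero: "?B = ?A" if "\<sigma> = 0"
  proof -
    have "S = {}"
      using that assms(5,6) finite_verts by (metis card_0_eq finite_subset)
    then show ?thesis by (simp add: self_loop_graph_def)
  qed
  \<comment> \<open>With a loop at every vertex the added sum is exactly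
    \<open>x \<bullet> x\<close>, so the comparison holds with shift -1 and reverses the upper
    bound.\<close>
  have full: "lambda i ?A \<le> lambda i ?B + (- 1)" if "\<sigma> = n" and i: "i \<in> {1..n}" for i
  proof (rule lambda_le_of_quadratic_form_le[OF A A_sym B B_sym _ i])
    fix x :: "real vec" assume x: "x \<in> carrier_vec n"
    have "S = pverts G"
      using that(1) assms(2,5,6) finite_verts by (metis card_subset_eq)
    then have "vs ! k \<in> S" if "k < n" for k
      using that assms(4) len by (metis nth_mem)
    then have "{k. k < n \<and> vs ! k \<in> S} = {..<n}"
      by blast
    then show "x \<bullet> (?A *\<^sub>v x) \<le> x \<bullet> (?B *\<^sub>v x) + (- 1) * (x \<bullet> x)"
      using x by (simp add: qB xx)
  qed
  show ?thesis
  proof (intro conjI impI ballI)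
    fix i assume i: "i \<in> {1..n}"
    show "lambda i ?A \<le> lambda i ?B" using lower[OF i] by simp
    show "lambda i ?B \<le> lambda i ?A + 1" by (rule upper[OF i])
  next
    fix i assume "\<sigma> = 0"
    then show "lambda i ?B = lambda i ?A" by (simp only: zero)
  next
    fix i assume "\<sigma> = n" and i: "i \<in> {1..n}"
    then have "lambda i ?A + 1 \<le> lambda i ?B" using full[OF _ i] by linarith
    with upper[OF i] show "lambda i ?B = lambda i ?A + 1" by (rule antisym)
  qed
qed

end
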